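(* Let $d\ge3$ be an odd integer. There exists a constant $c_d>0$, depending only on $d$, such that for all integers $m\ge1$ and all $l\in\{0,\dots,m\}$ with $m+l$ even, $$|\lambda_{m,l,d}|\ge c_d\,m^{-1/2}.$$ This bound is asymptotically tight in the sense that the exponent $-1/2$ cannot be replaced by a greater one (i.e. for no $\beta>-1/2$ does there exist a constant $c>0$ with $|\lambda_{m,l,d}|\ge c\,m^{\beta}$ for all such $m,l$).
   Context: The numbers $\lambda_{m,l,d}$ (singular values of the odd part $\mathcal D^{(\mathrm{odd})}\colon L^2(\mathbb B^d)\to L^2(\mathbb S^{d-1}\times\mathbb S^{d-1})$ of the cone-beam transform $\mathcal Df(a,\omega)=\int_0^\infty f(a+t\omega)\,dt$ with sources on the sphere) are given by $$\lambda_{m,l,d}=\sqrt{\frac{N_{m+1,d}\,\mu_{m,d}^2\,|\mathbb S^{d-2}|}{|\mathbb S^{d-1}|^2}\;\sum_{n=m+1-l,\ n\text{ odd}}^{m+1+l}\nu_{n,d}^2\,N_{n,d}\,\int_{-1}^1P_{m+1,d}(t)\,P_{l,d}(t)\,P_{n,d}(t)\,(1-t^2)^{\frac{d-3}{2}}\,dt},$$ where - $|\mathbb S^{d-1}|=2\pi^{d/2}/\Gamma(d/2)$; - $N_{n,d}=\frac{(2n+d-2)(n+d-3)!}{n!(d-2)!}$; - $\mu_{m,d}=\sqrt{\frac{2^{d+1}\pi^{d-1}}{2m+d}}$ and $\nu_{n,d}=\frac{(-1)^{\frac{n+1}{2}}(n-1)!!}{(n+d-3)!!}$; - $P_{n,d}(t)=(-1)^n\frac{(d-3)!!}{(2n+d-3)!!}(1-t^2)^{\frac{3-d}{2}}\left(\frac{d}{dt}\right)^n(1-t^2)^{n+\frac{d-3}{2}}$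 is the Legendre polynomial of degree $n$ in dimension $d$ (so $P_{n,d}(1)=1$). Double factorials: $n!!=n(n-2)\cdots$ down to $2$ or $1$, with $0!!=1$. *)

theory Defs
  imports "HOL-Analysis.Analysis"
begin

fun double_fact :: "nat \<Rightarrow> nat" where
  "double_fact 0 = 1"
| "double_fact (Suc 0) = 1"
| "double_fact (Suc (Suc n)) = Suc (Suc n) * double_fact n"

text \<open>
  Throughout, \<open>d\<close> is the dimension of the ambient space, assumed to be at least \<open>3\<close>, so that
  none of the natural-number subtractions below truncates.
\<close>

text \<open>Indexed by the ambient dimension: this is \<open>|S^(d-1)|\<close>, and \<open>sphere_area (d - 1)\<close> is \<open>|S^(d-2)|\<close>.\<close>

definition sphere_area :: "nat \<Rightarrow> real" where
  "sphere_area d = 2 * pi powr (real d / 2) / Gamma (real d / 2)"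

definition harm_dim :: "nat \<Rightarrow> nat \<Rightarrow> real" where
  "harm_dim n d = real (2 * n + d - 2) * fact (n + d - 3) / (fact n * fact (d - 2))"

definition mu :: "nat \<Rightarrow> nat \<Rightarrow> real" where
  "mu m d = sqrt (2 ^ (d + 1) * pi ^ (d - 1) / real (2 * m + d))"

text \<open>Only used for odd \<open>n\<close>, where the division in the exponent is exact.\<close>

definition nu :: "nat \<Rightarrow> nat \<Rightarrow> real" where
  "nu n d = (- 1) ^ ((n + 1) div 2) * real (double_fact (n - 1)) / real (double_fact (n + d - 3))"

text \<open>
  The Rodrigues formula. It is meaningful for \<open>-1 < t < 1\<close>; at the end points the factor
  \<open>(1 - t\<^sup>2) powr ((3 - d) / 2)\<close> is the value that HOL assigns to a power with base \<open>0\<close>.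
\<close>

definition rodrigues :: "nat \<Rightarrow> nat \<Rightarrow> real \<Rightarrow> real" where
  "rodrigues n d t =
     (- 1) ^ n * (real (double_fact (d - 3)) / real (double_fact (2 * n + d - 3)))
     * (1 - t\<^sup>2) powr ((3 - real d) / 2)
     * (deriv ^^ n) (\<lambda>s. (1 - s\<^sup>2) powr (real n + (real d - 3) / 2)) t"

text \<open>
  The Legendre polynomial of degree \<open>n\<close> in dimension \<open>d\<close>, as a function on \<open>[-1, 1]\<close>: the limit
  is the continuous extension of the Rodrigues formula to the end points, with value \<open>1\<close> at \<open>1\<close>.
  The value is unspecified outside \<open>[-1, 1]\<close>.
\<close>

definition legendre :: "nat \<Rightarrow> nat \<Rightarrow> real \<Rightarrow> real" where
  "legendre n d t = Lim (at t within {-1<..<1}) (rodrigues n d)"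

definition lambda :: "nat \<Rightarrow> nat \<Rightarrow> nat \<Rightarrow> real" where
  "lambda m l d =
     sqrt (harm_dim (m + 1) d * (mu m d)\<^sup>2 * sphere_area (d - 1) / (sphere_area d)\<^sup>2
       * (\<Sum>n | odd n \<and> m + 1 - l \<le> n \<and> n \<le> m + 1 + l.
            (nu n d)\<^sup>2 * harm_dim n d
            * integral {-1..1} (\<lambda>t. legendre (m + 1) d t * legendre l d t * legendre n d t
                                     * (1 - t\<^sup>2) powr ((real d - 3) / 2))))"

end

theory Submission
  imports Defs "HOL-Computational_Algebra.Polynomial"
begin

text \<open>
  For odd \<open>d = 2 * k + 3\<close> the weight \<open>(1 - t\<^sup>2) powr ((d - 3) / 2)\<close> is the polynomial \<open>(1 - t\<^sup>2) ^ k\<close>,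
  and the Rodrigues formula yields polynomials \<open>P n\<close> with \<open>P n 1 = 1\<close> and a simple three-term
  recurrence (\<open>legendre_eq\<close>). Write \<open>I n\<close> for the integral of \<open>P (m + 1) * P l * P n\<close> against this
  weight, so that \<open>\<lambda>\<^sup>2\<close> is a product of explicit factors with the sum of \<open>\<nu>\<^sup>2 * N * I\<close>.

  The argument rests on two facts about the numbers \<open>I n\<close>. First, they are nonnegative
  (\<open>triple_integral_nonneg\<close>): suitably normalised, they solve a discrete wave equation in the two
  degrees \<open>m + 1\<close> and \<open>l\<close>, to which a discrete maximum principle applies (\<open>discrete_wave_nonneg\<close>).
  Second, the sum of \<open>N n * I n\<close> is the total mass of the weight, for all \<open>m\<close> and \<open>l\<close>
  (\<open>sum_triple_integrals\<close>): evaluate the expansion of \<open>P (m + 1) * P l\<close> in Legendre polynomials at \<open>1\<close>.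

  So the sum of \<open>\<nu>\<^sup>2 * N * I\<close> is at least the total mass times the least \<open>\<nu>\<^sup>2\<close> in the range
  \<open>n \<le> 2 * m + 1\<close>. Here \<open>\<nu>\<^sup>2\<close> is of order \<open>n powr (2 - d)\<close>, hence of order at least \<open>m powr (2 - d)\<close>,
  while \<open>N (m + 1)\<close> has order \<open>m powr (d - 2)\<close> and \<open>\<mu>\<^sup>2\<close> has order \<open>1 / m\<close>. This gives the lower bound
  \<open>\<lambda>\<^sup>2 \<ge> c / m\<close>. For \<open>l = 0\<close> and even \<open>m\<close> the sum has the single term \<open>n = m + 1\<close>, and the
  same estimates give \<open>\<lambda>\<^sup>2 \<le> C / m\<close>, so the exponent is optimal.
\<close>

section \<open>A maximum principle for a discrete wave equation\<close>

text \<open>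
  Summation of one row of the wave equation below. Because the two coefficients at a node add
  up to \<open>1\<close>, the sum collapses to the plain sum of \<open>f\<close> with a correction at the two end nodes only.
\<close>

lemma sum_shifted_pairs:
  fixes \<alpha> \<gamma> f :: "nat \<Rightarrow> real"
  assumes "\<And>n. \<alpha> n + \<gamma> n = 1"
  shows "(\<Sum>j\<le>n. \<alpha> (s + 2 * j + 2) * f (s + 2 * j + 2) + \<gamma> (s + 2 * j) * f (s + 2 * j))
    = (\<Sum>j\<le>Suc n. f (s + 2 * j)) - \<alpha> s * f s - \<gamma> (s + 2 * Suc n) * f (s + 2 * Suc n)"
proof (induction n)
  case 0
  have "f s = \<alpha> s * f s + \<gamma> s * f s"
    and "f (s+2) = \<alpha> (s+2) * f (s+2) + \<gamma> (s+2) * f (s+2)"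
    using assms by (metis distrib_right mult_1)+
  then show ?case by (simp add: eval_nat_numeral)
next
  case (Suc n)
  have "f (s + 2 * Suc (Suc n)) = \<alpha> (s + 2 * Suc (Suc n)) * f (s + 2 * Suc (Suc n))
      + \<gamma> (s + 2 * Suc (Suc n)) * f (s + 2 * Suc (Suc n))"
    using assms by (metis distrib_right mult_1)
  then show ?case using Suc by (simp add: eval_nat_numeral)
qed

text \<open>
  A discrete maximum principle in the style of Szwarc. The function \<open>v\<close> solves a discrete wave
  equation, with \<open>y\<close> as time, and is nonnegative at time \<open>0\<close>. Summing the equation over the backward
  light cone of the node \<open>(a, l + 1)\<close>, with \<open>l + 1 \<le> a\<close>, cancels all inner nodes, because
  \<open>\<alpha> n + \<gamma> n = 1\<close> does not depend on \<open>n\<close>. What is left expresses \<open>\<alpha> (l + 1) * v a (l + 1)\<close> as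
  a combination of the values of \<open>v\<close> on the two edges of the cone, with coefficients
  \<open>\<gamma> x - \<alpha> y\<close> on the left edge and \<open>\<alpha> x - \<alpha> y\<close> on the right edge; on both edges \<open>y \<le> x\<close>, so these are
  nonnegative by \<open>\<alpha> \<le> 1 / 2\<close> and by monotonicity, respectively. All centres of the summed equations
  have positive space coordinate, so no equation is needed on the line \<open>x = 0\<close>.
\<close>

lemma discrete_wave_nonneg:
  fixes \<alpha> \<gamma> :: "nat \<Rightarrow> real" and v :: "nat \<Rightarrow> nat \<Rightarrow> real"
  assumes sum1: "\<And>n. \<alpha> n + \<gamma> n = 1"
    and zero: "\<alpha> 0 = 0" and pos: "\<And>n. \<alpha> (Suc n) > 0"
    and mono: "mono \<alpha>" and half: "\<And>n. \<alpha> n \<le> 1 / 2"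
    and wave0: "\<And>x. \<alpha> (x + 2) * v (x + 2) 0 + \<gamma> x * v x 0 = \<alpha> 1 * v (x + 1) 1"
    and wave: "\<And>x y. \<alpha> (x + 2) * v (x + 2) (Suc y) + \<gamma> x * v x (Suc y)
                 = \<alpha> (y + 2) * v (x + 1) (y + 2) + \<gamma> y * v (x + 1) y"
    and init: "\<And>x. v x 0 \<ge> 0"
    and "y \<le> x"
  shows "v x y \<ge> 0"
  using \<open>y \<le> x\<close>
proof (induction y arbitrary: x rule: less_induct)
  case (less y a)
  show ?case
  proof (cases y)
    case 0
    then show ?thesis using init by simp
  next
    case (Suc l)
    define b where "b = a - Suc l"
    have a: "a = b + Suc l" using less.prems Suc b_def by simp
    \<comment> \<open>Row \<open>z\<close> of the light cone: \<open>R\<close> is the sum of \<open>v\<close> over the row, \<open>vL\<close> and \<open>vR\<close> are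
      its values at the end nodes.\<close>
    define R where "R z = (\<Sum>j\<le>Suc l - z. v (b + z + 2 * j) z)" for z
    define vL where "vL z = v (b + z) z" for z
    define vR where "vR z = v (b + z + 2 * (Suc l - z)) z" for z
    \<comment> \<open>\<open>B\<close> is the net flux through the row; it does not decrease with \<open>z\<close>,
      and at the top row it is a positive multiple of the value at the apex.\<close>
    define B where "B z = \<alpha> (Suc z) * R (Suc z) - \<gamma> z * R z + \<gamma> z * (vL z + vR z)" for z
    have nn: "vL z \<ge> 0 \<and> vR z \<ge> 0" if "z \<le> l" for z
      unfolding vL_def vR_def using that Suc by (auto intro!: less.IH)
    have row: "(\<Sum>j\<le>l - z. \<alpha> (b + z + 2 * j + 2) * v (b + z + 2 * j + 2) z
                 + \<gamma> (b + z + 2 * j) * v (b + z + 2 * j) z)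
            = R z - \<alpha> (b + z) * vL z - \<gamma> (b + z + 2 * (Suc l - z)) * vR z" if "z \<le> l" for z
      using sum_shifted_pairs[OF sum1, where f = "\<lambda>x. v x z" and s = "b + z" and n = "l - z"] that
      unfolding R_def vL_def vR_def by (simp add: Suc_diff_le)
    have coefs: "\<gamma> z - \<alpha> (b + z) \<ge> 0" "\<gamma> z - \<gamma> (b + z + 2 * (Suc l - z)) \<ge> 0" for z
    proof -
      show "\<gamma> z - \<alpha> (b + z) \<ge> 0" using half[of "b + z"] half[of z] sum1[of z] by linarith
      show "\<gamma> z - \<gamma> (b + z + 2 * (Suc l - z)) \<ge> 0"
        using sum1[of z] sum1[of "b + z + 2 * (Suc l - z)"]
          monoD[OF mono, of z "b + z + 2 * (Suc l - z)"] by simp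
    qed
    have B_nonneg: "B z \<ge> 0" if "z \<le> l" for z
      using that
    proof (induction z)
      case 0
      have "\<gamma> 0 = 1" using zero sum1[of 0] by simp
      moreover have "R 0 - \<alpha> b * vL 0 - \<gamma> (b + 2 * Suc l) * vR 0 = \<alpha> 1 * R 1"
        using row[of 0] wave0 by (simp add: R_def sum_distrib_left add_ac)
      ultimately have "B 0 = (\<gamma> 0 - \<alpha> b) * vL 0 + (\<gamma> 0 - \<gamma> (b + 2 * Suc l)) * vR 0"
        unfolding B_def by (simp add: algebra_simps)
      then show ?case using coefs[of 0] nn[of 0] by simp
    next
      case (Suc z)
      let ?x = "b + Suc z"
      have "(\<Sum>j\<le>l - Suc z. \<alpha> (b + Suc z + 2 * j + 2) * v (b + Suc z + 2 * j + 2) (Suc z)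
                 + \<gamma> (b + Suc z + 2 * j) * v (b + Suc z + 2 * j) (Suc z))
          = (\<Sum>j\<le>l - Suc z. \<alpha> (z + 2) * v (b + z + 2 + 2 * j) (z + 2)
                             + \<gamma> z * v (b + z + 2 + 2 * j) z)"
        using wave by (intro sum.cong) (simp_all add: add_ac)
      also have "\<dots> = \<alpha> (z + 2) * R (z + 2) + \<gamma> z * (\<Sum>j\<le>l - Suc z. v (b + z + 2 + 2 * j) z)"
        by (simp add: R_def sum.distrib sum_distrib_left add_ac)
      also have "(\<Sum>j\<le>l - Suc z. v (b + z + 2 + 2 * j) z) = R z - vL z - vR z"
      proof -
        have e: "Suc l - z = Suc (Suc (l - Suc z))" using Suc.prems by simp
        have "R z = vL z + (\<Sum>j\<le>Suc (l - Suc z). v (b + z + 2 + 2 * j) z)"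
          unfolding R_def vL_def e by (subst sum.atMost_Suc_shift) (simp add: add_ac)
        also have "(\<Sum>j\<le>Suc (l - Suc z). v (b + z + 2 + 2 * j) z)
            = (\<Sum>j\<le>l - Suc z. v (b + z + 2 + 2 * j) z) + vR z"
          unfolding vR_def e by (simp add: add_ac)
        finally show ?thesis by simp
      qed
      finally have step: "R (Suc z) - \<alpha> ?x * vL (Suc z) - \<gamma> (?x + 2 * (Suc l - Suc z)) * vR (Suc z)
            = \<alpha> (z + 2) * R (z + 2) + \<gamma> z * (R z - vL z - vR z)"
        using row[of "Suc z"] Suc.prems by simp
      have "R (Suc z) = \<alpha> (Suc z) * R (Suc z) + \<gamma> (Suc z) * R (Suc z)"
        using sum1 by (metis distrib_right mult_1)
      then have "B (Suc z) = B z + (\<gamma> (Suc z) - \<alpha> ?x) * vL (Suc z)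
          + (\<gamma> (Suc z) - \<gamma> (?x + 2 * (Suc l - Suc z))) * vR (Suc z)"
        using step unfolding B_def by (simp add: algebra_simps)
      moreover have "B z \<ge> 0" using Suc by simp
      moreover have "(\<gamma> (Suc z) - \<alpha> ?x) * vL (Suc z) \<ge> 0"
        "(\<gamma> (Suc z) - \<gamma> (?x + 2 * (Suc l - Suc z))) * vR (Suc z) \<ge> 0"
        using coefs[of "Suc z"] nn[of "Suc z"] Suc.prems by (intro mult_nonneg_nonneg; simp)+
      ultimately show ?case by linarith
    qed
    have "R l = vL l + vR l" "R (Suc l) = v a (Suc l)"
      by (simp_all add: R_def vL_def vR_def a)
    then have "B l = \<alpha> (Suc l) * v a (Suc l)" unfolding B_def by simp
    then show ?thesis
      using B_nonneg[of l] pos[of l] Suc by (auto simp: zero_le_mult_iff)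
  qed
qed

section \<open>Legendre polynomials in odd dimension\<close>

text \<open>
  The Legendre polynomial of degree \<open>n\<close> in the odd dimension \<open>2 * k + 3\<close>, normalised to the value
  \<open>1\<close> at \<open>1\<close> and defined by its three-term recurrence. It is a Gegenbauer polynomial of index
  \<open>k + 1/2\<close>, and its weight \<open>(1 - t\<^sup>2) ^ k\<close> is a polynomial.
\<close>

fun legendre_poly :: "nat \<Rightarrow> nat \<Rightarrow> real poly" where
  "legendre_poly k 0 = 1"
| "legendre_poly k (Suc 0) = [:0, 1:]"
| "legendre_poly k (Suc (Suc n)) =
     smult (real (2 * n + 2 * k + 3) / real (n + 2 * k + 2)) ([:0, 1:] * legendre_poly k (Suc n))
     - smult (real (n + 1) / real (n + 2 * k + 2)) (legendre_poly k n)"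

lemma higher_pderiv_times_X:
  fixes p :: "real poly"
  shows "(pderiv ^^ Suc n) ([:0, 1:] * p)
     = [:0, 1:] * (pderiv ^^ Suc n) p + smult (real (Suc n)) ((pderiv ^^ n) p)"
proof (induction n)
  case 0
  then show ?case by (simp add: pderiv_mult pderiv_pCons)
next
  case (Suc n)
  have "(pderiv ^^ Suc (Suc n)) ([:0, 1:] * p) = pderiv ((pderiv ^^ Suc n) ([:0, 1:] * p))"
    by simp
  also have "\<dots> = [:0, 1:] * (pderiv ^^ Suc (Suc n)) p + smult (1 + real (Suc n)) ((pderiv ^^ Suc n) p)"
    unfolding Suc by (simp add: pderiv_add pderiv_mult pderiv_smult pderiv_pCons del: of_nat_Suc)
      (simp_all add: smult_add_left numeral_poly)
  finally show ?case by simp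
qed

text \<open>
  The polynomial \<open>1 - t\<^sup>2\<close>.
\<close>

abbreviation wt :: "real poly" where "wt \<equiv> [:1, 0, -1:]"

lemma pderiv_wt_power:
  "pderiv (wt ^ Suc n) = smult (- 2 * real (Suc n)) ([:0, 1:] * wt ^ n)"
  by (simp add: pderiv_power_Suc pderiv_pCons del: power_Suc)

text \<open>
  The derivatives \<open>D^n (1 - t\<^sup>2)^(n + k)\<close> satisfy a three-term recurrence. The auxiliary quantity
  \<open>v = D^n (1 - t\<^sup>2)^(n + 1 + k)\<close> is eliminated between two relations: one from differentiating the
  outer power once, the other from \<open>f = (1 - t\<^sup>2)^(n + k) - t\<^sup>2 (1 - t\<^sup>2)^(n + k)\<close> for
  \<open>f = (1 - t\<^sup>2)^(n + 1 + k)\<close>, where \<open>t (1 - t\<^sup>2)^(n + k)\<close> is a multiple of \<open>f'\<close>.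
\<close>

lemma rodrigues_poly_rec:
  fixes k n :: nat and x :: real
  defines "u \<equiv> \<lambda>j. poly ((pderiv ^^ j) (wt ^ (j + k))) x"
  shows "real (n + 2 * k + 2) * u (n + 2)
     = - 2 * real (n + 2 + k) * (real (2 * n + 2 * k + 3) * x * u (n + 1)
         + 2 * real (n + 1) * real (n + 1 + k) * u n)"
proof -
  define v where "v = poly ((pderiv ^^ n) (wt ^ Suc (n + k))) x"
  \<comment> \<open>Both relations are instances of the Leibniz rule for a product with \<open>t\<close>.\<close>
  have 1: "u (n + 2) = - 2 * real (n + 2 + k) * (x * u (n + 1) + real (n + 1) * v)"
  proof -
    have "(pderiv ^^ (n + 2)) (wt ^ (n + 2 + k))
       = (pderiv ^^ Suc n) (pderiv (wt ^ Suc (n + 1 + k)))"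
      by (simp add: funpow_swap1 del: power_Suc)
    also have "\<dots> = smult (- 2 * real (n + 2 + k)) ((pderiv ^^ Suc n) ([:0, 1:] * wt ^ (n + 1 + k)))"
      unfolding pderiv_wt_power by (subst higher_pderiv_smult) simp
    finally show ?thesis
      unfolding higher_pderiv_times_X u_def v_def by (simp add: algebra_simps)
  qed
  have 2: "2 * real (n + 1 + k) * v = 2 * real (n + 1 + k) * u n + x * u (n + 1) + real n * v"
  proof -
    have "smult (2 * real (n + 1 + k)) (wt ^ Suc (n + k))
        = smult (2 * real (n + 1 + k)) (wt ^ (n + k)) + [:0, 1:] * pderiv (wt ^ Suc (n + k))"
    proof -
      show ?thesis unfolding pderiv_wt_power
        by (intro poly_eq_poly_eq_iff[THEN iffD1] ext) (simp add: algebra_simps)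
    qed
    then have "(pderiv ^^ n) (smult (2 * real (n + 1 + k)) (wt ^ Suc (n + k)))
        = (pderiv ^^ n) (smult (2 * real (n + 1 + k)) (wt ^ (n + k)))
          + (pderiv ^^ n) ([:0, 1:] * pderiv (wt ^ Suc (n + k)))"
      by (simp only: higher_pderiv_add)
    moreover have "(pderiv ^^ n) ([:0, 1:] * pderiv (wt ^ Suc (n + k)))
        = [:0, 1:] * (pderiv ^^ (n + 1)) (wt ^ (n + 1 + k)) + smult (real n) ((pderiv ^^ n) (wt ^ Suc (n + k)))"
    proof (cases n)
      case (Suc m)
      then show ?thesis unfolding Suc higher_pderiv_times_X
        by (simp add: funpow_swap1 del: power_Suc)
    qed simp
    ultimately have "smult (2 * real (n + 1 + k)) ((pderiv ^^ n) (wt ^ Suc (n + k)))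
        = smult (2 * real (n + 1 + k)) ((pderiv ^^ n) (wt ^ (n + k)))
          + ([:0, 1:] * (pderiv ^^ (n + 1)) (wt ^ (n + 1 + k))
             + smult (real n) ((pderiv ^^ n) (wt ^ Suc (n + k))))"
      by (simp only: higher_pderiv_smult)
    from arg_cong[OF this, of "\<lambda>p. poly p x"] show ?thesis
      unfolding u_def v_def
        by (simp only: poly_add poly_smult poly_mult poly_pCons poly_0 mult_zero_right
          add_0 mult_1_right add_0_right add.assoc)
  qed
  have 3: "real (n + 2 * k + 2) * v = 2 * real (n + 1 + k) * u n + x * u (n + 1)"
    using 2 by (simp add: algebra_simps)
  have "real (n + 2 * k + 2) * u (n + 2)
     = - 2 * real (n + 2 + k) * (real (n + 2 * k + 2) * x * u (n + 1)
         + real (n + 1) * (real (n + 2 * k + 2) * v))"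
    unfolding 1 by (simp only: algebra_simps)
  also have "\<dots> = - 2 * real (n + 2 + k) * (real (2 * n + 2 * k + 3) * x * u (n + 1)
         + 2 * real (n + 1) * real (n + 1 + k) * u n)"
    unfolding 3 by (simp add: algebra_simps)
  finally show ?thesis .
qed

lemma double_fact_pos [simp]: "double_fact n > 0"
  by (induction n rule: double_fact.induct) auto

text \<open>
  The Rodrigues formula, with the division by the weight cleared.
\<close>

lemma rodrigues_legendre_poly:
  "poly ((pderiv ^^ n) (wt ^ (n + k))) x
     = (- 1) ^ n * (real (double_fact (2 * n + 2 * k)) / real (double_fact (2 * k)))
       * (1 - x\<^sup>2) ^ k * poly (legendre_poly k n) x"
proof (induction n rule: induct_nat_012)
  case 0
  then show ?case by (simp add: power2_eq_square less_imp_neq[OF double_fact_pos, symmetric])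
next
  case 1
  have "double_fact (2 + 2 * k) = (2 * k + 2) * double_fact (2 * k)" by simp
  then have "real (double_fact (2 * Suc 0 + 2 * k)) / real (double_fact (2 * k)) = 2 * real (Suc k)"
    by (simp add: less_imp_neq[OF double_fact_pos, symmetric] field_simps)
  moreover have "poly ((pderiv ^^ Suc 0) (wt ^ (Suc 0 + k))) x = - 2 * real (Suc k) * (x * (1 - x\<^sup>2) ^ k)"
    using pderiv_wt_power[of k] by (simp add: power2_eq_square del: power_Suc)
  ultimately show ?case by (simp only:) simp
next
  case (ge2 n)
  define C where "C = real (double_fact (2 * n + 2 * k)) / real (double_fact (2 * k))"
  have C1: "real (double_fact (2 * Suc n + 2 * k)) / real (double_fact (2 * k)) = 2 * real (n + 1 + k) * C"
    unfolding C_def by (simp add: algebra_simps add_divide_distrib)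
  have C2: "real (double_fact (2 * Suc (Suc n) + 2 * k)) / real (double_fact (2 * k))
      = 4 * real (n + 2 + k) * real (n + 1 + k) * C"
    unfolding C_def by (simp add: algebra_simps add_divide_distrib)
  define A where "A = real (n + 2 * k + 2)"
  have A: "A > 0" by (simp add: A_def)
  have g: "A * poly (legendre_poly k (Suc (Suc n))) x
      = real (2 * n + 2 * k + 3) * x * poly (legendre_poly k (Suc n)) x
        - real (n + 1) * poly (legendre_poly k n) x"
    using A unfolding legendre_poly.simps A_def[symmetric] by (simp add: field_simps)
  have "A * poly ((pderiv ^^ (n + 2)) (wt ^ (n + 2 + k))) x
     = - 2 * real (n + 2 + k) * (real (2 * n + 2 * k + 3) * x *
         ((- 1) ^ Suc n * (2 * real (n + 1 + k) * C) * (1 - x\<^sup>2) ^ k * poly (legendre_poly k (Suc n)) x)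
         + 2 * real (n + 1) * real (n + 1 + k) * ((- 1) ^ n * C * (1 - x\<^sup>2) ^ k * poly (legendre_poly k n) x))"
    unfolding A_def rodrigues_poly_rec
    using ge2 unfolding C1 C_def[symmetric] by simp
  also have "\<dots> = (- 1) ^ n * (4 * real (n + 2 + k) * real (n + 1 + k) * C) * (1 - x\<^sup>2) ^ k
       * (A * poly (legendre_poly k (Suc (Suc n))) x)"
    unfolding g by (simp add: algebra_simps)
  finally show ?case using A unfolding C2 by simp
qed

lemma higher_deriv_poly_on:
  fixes f :: "real \<Rightarrow> real"
  assumes "open S" and "\<And>x. x \<in> S \<Longrightarrow> f x = poly p x" and "x \<in> S"
  shows "(deriv ^^ n) f x = poly ((pderiv ^^ n) p) x"
  using assms(3)
proof (induction n arbitrary: x)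
  case 0
  then show ?case using assms(2) by simp
next
  case (Suc n)
  have "((deriv ^^ n) f has_real_derivative poly (pderiv ((pderiv ^^ n) p)) x) (at x)"
    by (rule has_field_derivative_transform_within_open[OF poly_DERIV \<open>open S\<close> Suc.prems])
       (simp add: Suc.IH)
  then show ?case by (simp add: DERIV_imp_deriv)
qed

lemma rodrigues_eq:
  assumes "-1 < t" "t < 1"
  shows "rodrigues n (2 * k + 3) t = poly (legendre_poly k n) t"
proof -
  have sq: "1 - s\<^sup>2 > 0" if "s \<in> {-1<..<1}" for s :: real
    using that by (simp add: abs_square_less_1 abs_less_iff)
  have "(deriv ^^ n) (\<lambda>s. (1 - s\<^sup>2) powr (real n + real k)) t = poly ((pderiv ^^ n) (wt ^ (n + k))) t"
  proof (rule higher_deriv_poly_on[where S = "{-1<..<1}"])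
    show "(1 - s\<^sup>2) powr (real n + real k) = poly (wt ^ (n + k)) s" if "s \<in> {-1<..<1}" for s
      using sq[OF that] powr_realpow[of "1 - s\<^sup>2" "n + k"] by (simp add: power2_eq_square)
  qed (use assms in auto)
  then have "rodrigues n (2 * k + 3) t
      = (- 1) ^ n * (real (double_fact (2 * k)) / real (double_fact (2 * n + 2 * k)))
        * (1 - t\<^sup>2) powr (- real k)
        * ((- 1) ^ n * (real (double_fact (2 * n + 2 * k)) / real (double_fact (2 * k)))
           * (1 - t\<^sup>2) ^ k * poly (legendre_poly k n) t)"
    unfolding rodrigues_def by (simp add: rodrigues_legendre_poly diff_divide_distrib)
  also have "\<dots> = ((- 1) ^ n * (- 1) ^ n) * ((1 - t\<^sup>2) powr (- real k) * (1 - t\<^sup>2) ^ k) * poly (legendre_poly k n) t"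
    by (simp add: less_imp_neq[OF double_fact_pos, symmetric])
  also have "(1 - t\<^sup>2) powr (- real k) * (1 - t\<^sup>2) ^ k = 1"
    using sq[of t] assms by (simp add: powr_minus powr_realpow)
  also have "(- 1 :: real) ^ n * (- 1) ^ n = 1" by (simp flip: power_mult_distrib)
  finally show ?thesis by simp
qed

lemma legendre_eq:
  assumes "t \<in> {-1..1}"
  shows "legendre n (2 * k + 3) t = poly (legendre_poly k n) t"
  unfolding legendre_def
proof (rule tendsto_Lim)
  show "at t within {-1<..<1} \<noteq> bot"
  proof -
    consider "t = -1" | "t = 1" | "t \<in> {-1<..<1}" using assms by fastforce
    then show ?thesis
    proof cases
      case 3
      show ?thesis
        unfolding at_within_open[OF 3 open_greaterThanLessThan] by (rule at_neq_bot)
    qed (simp_all add: trivial_limit_within islimpt_greaterThanLessThan1 islimpt_greaterThanLessThan2)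
  qed
  have "((poly (legendre_poly k n)) \<longlongrightarrow> poly (legendre_poly k n) t) (at t within {-1<..<1})"
    using poly_isCont[where p = "legendre_poly k n" and x = t] unfolding isCont_def
      by (rule tendsto_within_subset) simp
  then show "(rodrigues n (2 * k + 3) \<longlongrightarrow> poly (legendre_poly k n) t) (at t within {-1<..<1})"
    by (rule Lim_transform_eventually) (auto simp: eventually_at_filter rodrigues_eq)
qed

lemma legendre_poly_at_1: "poly (legendre_poly k n) 1 = 1"
  by (induction n rule: induct_nat_012) (simp_all flip: diff_divide_distrib)

section \<open>Orthogonality and linearization of products\<close>

text \<open>
  The coefficient of the lower neighbour in the recurrence
  \<open>t * P n = (1 - alpha k n) * P (n + 1) + alpha k n * P (n - 1)\<close> for \<open>n \<ge> 1\<close>. The two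
  coefficients add up to \<open>1\<close> because all the polynomials have the value \<open>1\<close> at \<open>1\<close>.
\<close>

definition alpha :: "nat \<Rightarrow> nat \<Rightarrow> real" where
  "alpha k n = real n / real (2 * n + 2 * k + 1)"

lemma X_times_legendre_poly:
  "[:0, 1:] * legendre_poly k (Suc n)
     = smult (1 - alpha k (Suc n)) (legendre_poly k (n + 2)) + smult (alpha k (Suc n)) (legendre_poly k n)"
proof -
  define p q where "p = [:0, 1:] * legendre_poly k (Suc n)" and "q = legendre_poly k n"
  define A where "A = real (n + 2 * k + 2)"
  have A: "A > 0" "real (2 * n + 2 * k + 3) = A + real (n + 1)" by (simp_all add: A_def)
  have al: "alpha k (Suc n) = real (n + 1) / (A + real (n + 1))"
    using A by (simp add: alpha_def A_def algebra_simps)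
  have "1 - alpha k (Suc n) = A / (A + real (n + 1))"
    using A by (simp add: al field_simps)
  moreover have "legendre_poly k (n + 2) = smult ((A + real (n + 1)) / A) p - smult (real (n + 1) / A) q"
    using A by (simp add: p_def q_def A_def add_ac)
  ultimately show ?thesis unfolding p_def[symmetric] q_def[symmetric] al
    using A by (simp add: smult_diff_right)
qed

text \<open>
  \<open>p\<close> is a linear combination of the Legendre polynomials with degrees in \<open>A\<close>. The coefficients on
  \<open>A\<close> are a function on all of \<open>nat\<close>; the notion is only meaningful for finite \<open>A\<close>.
\<close>

definition spanned :: "nat \<Rightarrow> nat set \<Rightarrow> real poly \<Rightarrow> bool" where
  "spanned k A p \<longleftrightarrow> (\<exists>c. p = (\<Sum>n\<in>A. smult (c n) (legendre_poly k n)))"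

lemma spanned_add:
  assumes "spanned k A p" "spanned k A q" shows "spanned k A (p + q)"
proof -
  obtain c e where "p = (\<Sum>n\<in>A. smult (c n) (legendre_poly k n))"
    "q = (\<Sum>n\<in>A. smult (e n) (legendre_poly k n))"
    using assms spanned_def by auto
  then have "p + q = (\<Sum>n\<in>A. smult (c n + e n) (legendre_poly k n))"
    by (simp add: smult_add_left sum.distrib)
  then show ?thesis unfolding spanned_def by (rule exI[of _ "\<lambda>n. c n + e n"])
qed

lemma spanned_smult:
  assumes "spanned k A p" shows "spanned k A (smult c p)"
proof -
  obtain e where "p = (\<Sum>n\<in>A. smult (e n) (legendre_poly k n))" using assms spanned_def by auto
  then have "smult c p = (\<Sum>n\<in>A. smult (c * e n) (legendre_poly k n))"
    by (simp add: poly_eq_poly_eq_iff[symmetric] fun_eq_iff poly_sum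
        sum_distrib_left mult.assoc)
  then show ?thesis unfolding spanned_def by (rule exI[of _ "\<lambda>n. c * e n"])
qed

lemma spanned_mono:
  assumes "spanned k A p" "A \<subseteq> B" "finite B" shows "spanned k B p"
proof -
  obtain e where "p = (\<Sum>n\<in>A. smult (e n) (legendre_poly k n))" using assms spanned_def by auto
  also have "\<dots> = (\<Sum>n\<in>B. smult (if n \<in> A then e n else 0) (legendre_poly k n))"
    using assms by (intro sum.mono_neutral_cong_left) auto
  finally show ?thesis unfolding spanned_def by (rule exI[where x = "\<lambda>n. if n \<in> A then e n else 0"])
qed

lemma spanned_legendre_poly: "spanned k {n} (legendre_poly k n)"
  unfolding spanned_def by (rule exI[of _ "\<lambda>_. 1"]) simp

text \<open>
  The degrees that can occur in the linearization of the product of the Legendre polynomials of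
  degrees \<open>a\<close> and \<open>l\<close>, as in the Clebsch--Gordan rule.
  It is used for \<open>l \<le> a\<close> only, so the subtraction does not truncate.
\<close>

definition linearization_range :: "nat \<Rightarrow> nat \<Rightarrow> nat set" where
  "linearization_range a l = {n. a - l \<le> n \<and> n \<le> a + l \<and> even (n + a + l)}"

lemma finite_linearization_range [simp]: "finite (linearization_range a l)"
  unfolding linearization_range_def by (rule finite_subset[of _ "{..a + l}"]) auto

lemma spanned_mult: "l \<le> a \<Longrightarrow> spanned k (linearization_range a l) (legendre_poly k a * legendre_poly k l)"
proof (induction l arbitrary: a rule: induct_nat_012)
  case 0
  show ?case using spanned_mono[OF spanned_legendre_poly[of k a], of "linearization_range a 0"]
    by (simp add: linearization_range_def)
next
  case 1
  then obtain b where a: "a = Suc b" by (cases a) auto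
  have "legendre_poly k a * legendre_poly k (Suc 0) = [:0, 1:] * legendre_poly k (Suc b)"
    by (simp add: a)
  also have "spanned k (linearization_range a (Suc 0)) \<dots>"
    unfolding X_times_legendre_poly
    by (intro spanned_add spanned_smult spanned_mono[OF spanned_legendre_poly])
       (auto simp: linearization_range_def a)
  finally show ?case .
next
  case (ge2 l)
  then obtain b where a: "a = Suc b" by (cases a) auto
  define e f where "e = real (2 * l + 2 * k + 3) / real (l + 2 * k + 2)"
    and "f = real (l + 1) / real (l + 2 * k + 2)"
  have "legendre_poly k a * legendre_poly k (Suc (Suc l))
      = smult e ([:0, 1:] * legendre_poly k (Suc b) * legendre_poly k (Suc l))
        + smult (- f) (legendre_poly k a * legendre_poly k l)"
    unfolding legendre_poly.simps e_def[symmetric] f_def[symmetric] a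
    by (simp add: algebra_simps)
  also have "\<dots> = smult e (smult (1 - alpha k (Suc b)) (legendre_poly k (b + 2) * legendre_poly k (Suc l))
      + smult (alpha k (Suc b)) (legendre_poly k b * legendre_poly k (Suc l)))
        + smult (- f) (legendre_poly k a * legendre_poly k l)"
    unfolding X_times_legendre_poly by (simp add: algebra_simps)
  also have "spanned k (linearization_range a (Suc (Suc l))) \<dots>"
  proof (intro spanned_add spanned_smult)
    show "spanned k (linearization_range a (Suc (Suc l))) (legendre_poly k (b + 2) * legendre_poly k (Suc l))"
      by (rule spanned_mono[OF ge2.IH(2)]) (use ge2.prems a in \<open>auto simp: linearization_range_def\<close>)
    show "spanned k (linearization_range a (Suc (Suc l))) (legendre_poly k b * legendre_poly k (Suc l))"
      by (rule spanned_mono[OF ge2.IH(2)]) (use ge2.prems a in \<open>auto simp: linearization_range_def\<close>)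
    show "spanned k (linearization_range a (Suc (Suc l))) (legendre_poly k a * legendre_poly k l)"
      by (rule spanned_mono[OF ge2.IH(1)]) (use ge2.prems a in \<open>auto simp: linearization_range_def\<close>)
  qed
  finally show ?case .
qed

text \<open>
  Integration against the weight \<open>(1 - t\<^sup>2) ^ k\<close>, as a linear functional on polynomials.
\<close>

definition wint :: "nat \<Rightarrow> real poly \<Rightarrow> real" where
  "wint k p = integral {-1..1} (\<lambda>t. poly p t * (1 - t\<^sup>2) ^ k)"

lemma wint_integrable:
  fixes p :: "real poly"
  shows "(\<lambda>t. poly p t * (1 - t\<^sup>2) ^ k) integrable_on {-1..1}"
  by (intro integrable_continuous_real continuous_intros)

lemma wint_add: "wint k (p + q) = wint k p + wint k q"
  unfolding wint_def by (simp add: distrib_right integral_add[OF wint_integrable wint_integrable])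

lemma wint_smult: "wint k (smult c p) = c * wint k p"
  unfolding wint_def by (simp add: mult.assoc)

lemma wint_sum: "wint k (sum f A) = (\<Sum>x\<in>A. wint k (f x))"
  by (induction A rule: infinite_finite_induct) (simp_all add: wint_add, simp_all add: wint_def)

lemma wint_1_pos: "wint k 1 > 0"
proof -
  have "\<exists>t\<in>{-1..1::real}. (1 - t\<^sup>2) ^ k \<noteq> 0" by (rule bexI[of _ 0]) auto
  moreover have "0 \<le> 1 - t\<^sup>2" if "t \<in> {-1..1}" for t :: real
    using that by (simp add: abs_square_le_1 abs_le_iff)
  then have nonneg: "0 \<le> (1 - t\<^sup>2) ^ k" if "t \<in> {-1..1}" for t :: real
    using that by simp
  moreover have "continuous_on {-1..1::real} (\<lambda>t. (1 - t\<^sup>2) ^ k)"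
    by (intro continuous_intros)
  ultimately have "wint k 1 \<noteq> 0"
    using integral_eq_0_iff[of "-1 :: real" 1 "\<lambda>t. (1 - t\<^sup>2) ^ k"] by (auto simp: wint_def)
  moreover have "wint k 1 \<ge> 0"
    unfolding wint_def using nonneg by (intro integral_nonneg[OF wint_integrable]) simp
  ultimately show ?thesis by simp
qed

lemma wt_dvd_higher_pderiv: "wt ^ r dvd (pderiv ^^ j) (wt ^ (j + r))"
proof -
  have step: "wt ^ r dvd pderiv p" if "wt ^ Suc r dvd p" for r and p :: "real poly"
  proof -
    obtain q where "p = wt ^ Suc r * q" using \<open>wt ^ Suc r dvd p\<close> by (rule dvdE)
    then have "pderiv p = wt ^ r * (wt * pderiv q + smult (- 2 * real (Suc r)) ([:0, 1:] * q))"
      by (simp only: pderiv_mult pderiv_wt_power) (simp add: algebra_simps)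
    then show ?thesis by simp
  qed
  have "wt ^ r dvd (pderiv ^^ j) p" if "wt ^ (j + r) dvd p" for p :: "real poly"
    using that
  proof (induction j arbitrary: p)
    case (Suc j)
    then show ?case using step[of "j + r" p] by (simp add: funpow_swap1 del: power_Suc)
  qed simp
  from this[OF dvd_refl] show ?thesis .
qed

text \<open>
  By the Rodrigues formula the integrand is a derivative whose primitive still contains a factor
  \<open>1 - t\<^sup>2\<close>.
\<close>

lemma wint_legendre_poly:
  assumes "n \<noteq> 0" shows "wint k (legendre_poly k n) = 0"
proof -
  obtain j where n: "n = Suc j" using assms by (cases n) auto
  define C where "C = (- 1) ^ n * (real (double_fact (2 * n + 2 * k)) / real (double_fact (2 * k)))"
  have C: "C \<noteq> 0" by (simp add: C_def less_imp_neq[OF double_fact_pos, symmetric])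
  define F where "F = (pderiv ^^ j) (wt ^ (n + k))"
  have "((\<lambda>t. poly (pderiv F) t) has_integral (poly F 1 - poly F (-1))) {-1..1}"
    by (rule fundamental_theorem_of_calculus)
       (auto simp: has_real_derivative_iff_has_vector_derivative[symmetric] intro: DERIV_subset[OF poly_DERIV])
  moreover have "wt dvd F"
    using wt_dvd_higher_pderiv[of "Suc k" j] dvd_trans[of wt "wt ^ Suc k" F]
    unfolding F_def n by (simp del: power_Suc)
  then have "poly F 1 = 0" "poly F (-1) = 0" by (auto elim!: dvdE)
  moreover have "poly (pderiv F) t = C * (poly (legendre_poly k n) t * (1 - t\<^sup>2) ^ k)" for t
    using rodrigues_legendre_poly[of n k t] unfolding F_def C_def n by simp
  ultimately have "((\<lambda>t. C * (poly (legendre_poly k n) t * (1 - t\<^sup>2) ^ k)) has_integral 0) {-1..1}"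
    by simp
  then have "integral {-1..1} (\<lambda>t. C * (poly (legendre_poly k n) t * (1 - t\<^sup>2) ^ k)) = 0"
    by (rule integral_unique)
  then show ?thesis using C by (simp add: wint_def)
qed

text \<open>
  No integration by parts is needed here: for \<open>n \<noteq> m\<close>, the linearization of the product
  involves positive degrees only.
\<close>

lemma legendre_poly_orthogonal:
  assumes "n \<noteq> m" shows "wint k (legendre_poly k n * legendre_poly k m) = 0"
proof -
  have *: "wint k (legendre_poly k a * legendre_poly k l) = 0" if "l < a" for a l
  proof -
    have "spanned k (linearization_range a l) (legendre_poly k a * legendre_poly k l)" using that
      by (intro spanned_mult) simp
    then obtain c where c: "legendre_poly k a * legendre_poly k l
      = (\<Sum>n\<in>linearization_range a l. smult (c n) (legendre_poly k n))"
      unfolding spanned_def by blast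
    show ?thesis unfolding c wint_sum wint_smult
      using that by (intro sum.neutral) (auto simp: linearization_range_def wint_legendre_poly)
  qed
  show ?thesis using *[of n m] *[of m n] assms by (cases n m rule: linorder_cases)
    (auto simp: mult.commute)
qed

section \<open>Integrals of products of three Legendre polynomials\<close>

lemma harm_dim_eq:
  "harm_dim n (2 * k + 3)
     = real (2 * n + 2 * k + 1) * fact (n + 2 * k) / (fact n * fact (2 * k + 1))"
proof -
  have "2 * n + (2 * k + 3) - 2 = 2 * n + 2 * k + 1" "n + (2 * k + 3) - 3 = n + 2 * k"
    "2 * k + 3 - 2 = 2 * k + 1"
    by simp_all
  then show ?thesis unfolding harm_dim_def by (simp only:)
qed

lemma harm_dim_pos: "harm_dim n (2 * k + 3) > 0"
  unfolding harm_dim_eq by (intro divide_pos_pos mult_pos_pos fact_gt_zero) simp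

lemma harm_dim_0: "harm_dim 0 (2 * k + 3) = 1"
proof -
  have f: "(fact (2 * k + 1) :: real) = real (2 * k + 1) * fact (2 * k)"
    by (metis Suc_eq_plus1 fact_Suc)
  have "real (2 * k + 1) * fact (2 * k) \<noteq> 0"
    unfolding f[symmetric] by (rule fact_nonzero)
  then show ?thesis unfolding harm_dim_eq f
    by (simp only: mult_0_right add_0 fact_0 mult_1) (rule divide_self)
qed

text \<open>
  The detailed balance relation between the weights \<open>harm_dim\<close> and the recurrence coefficients. It
  makes \<open>harm_dim n\<close> the reciprocal of the squared norm, up to the factor \<open>wint k 1\<close>.
\<close>

lemma harm_dim_Suc:
  "harm_dim (Suc n) (2 * k + 3) * alpha k (Suc n) = harm_dim n (2 * k + 3) * (1 - alpha k n)"
proof -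
  define F G H where "F = (fact (n + 2 * k) :: real)" and "G = (fact n :: real)"
    and "H = (fact (2 * k + 1) :: real)"
  have nz: "F > 0" "G > 0" "H > 0" unfolding F_def G_def H_def by simp_all
  have "harm_dim (Suc n) (2 * k + 3)
      = real (2 * n + 2 * k + 3) * (real (n + 2 * k + 1) * F) / (real (n + 1) * G * H)"
    unfolding harm_dim_eq F_def G_def H_def
    by (simp only: fact_Suc add_Suc) (simp add: algebra_simps del: fact_Suc)
  moreover have "harm_dim n (2 * k + 3) = real (2 * n + 2 * k + 1) * F / (G * H)"
    unfolding harm_dim_eq F_def G_def H_def ..
  moreover have "alpha k (Suc n) = real (n + 1) / real (2 * n + 2 * k + 3)"
    unfolding alpha_def by simp
  moreover have "1 - alpha k n = real (n + 2 * k + 1) / real (2 * n + 2 * k + 1)"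
    unfolding alpha_def by (simp add: field_simps)
  ultimately show ?thesis using nz by (simp del: of_nat_add of_nat_Suc)
qed

lemma legendre_poly_norm: "harm_dim n (2 * k + 3) * wint k (legendre_poly k n * legendre_poly k n) = wint k 1"
proof (induction n)
  case 0
  then show ?case by (simp add: harm_dim_0)
next
  case (Suc n)
  define h where "h j = wint k (legendre_poly k j * legendre_poly k j)" for j
  have "wint k ([:0, 1:] * legendre_poly k (Suc n) * legendre_poly k n) = alpha k (Suc n) * h n"
    unfolding X_times_legendre_poly distrib_right wint_add mult_smult_left wint_smult h_def
    by (simp add: legendre_poly_orthogonal del: legendre_poly.simps)
  moreover have "wint k ([:0, 1:] * legendre_poly k n * legendre_poly k (Suc n))
      = (1 - alpha k n) * h (Suc n)"
  proof (cases n)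
    case 0
    then show ?thesis by (simp add: h_def alpha_def)
  next
    case (Suc j)
    show ?thesis
      unfolding Suc X_times_legendre_poly distrib_right wint_add mult_smult_left wint_smult h_def
      by (simp add: legendre_poly_orthogonal del: legendre_poly.simps)
  qed
  ultimately have "alpha k (Suc n) * h n = (1 - alpha k n) * h (Suc n)"
    by (simp only: mult_ac)
  then have "alpha k (Suc n) * (harm_dim n (2 * k + 3) * h n)
      = harm_dim n (2 * k + 3) * (1 - alpha k n) * h (Suc n)"
    by (metis (no_types) mult.assoc mult.left_commute)
  also have "\<dots> = alpha k (Suc n) * (harm_dim (Suc n) (2 * k + 3) * h (Suc n))"
    unfolding harm_dim_Suc[symmetric] by simp
  finally show ?case using Suc unfolding h_def by (simp add: alpha_def del: of_nat_Suc)
qed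

text \<open>
  The summands are, up to the factor \<open>wint k 1\<close>, the coefficients in the linearization of
  \<open>P a * P l\<close>, and these add up to \<open>P a 1 * P l 1 = 1\<close>.
\<close>

lemma sum_triple_integrals:
  assumes "l \<le> a"
  shows "(\<Sum>n\<in>linearization_range a l. 
    harm_dim n (2 * k + 3) * wint k (legendre_poly k a * legendre_poly k l * legendre_poly k n))
    = wint k 1"
proof -
  obtain c where c: "legendre_poly k a * legendre_poly k l
      = (\<Sum>n\<in>linearization_range a l. smult (c n) (legendre_poly k n))"
    using spanned_mult[OF assms] unfolding spanned_def by blast
  have "poly (legendre_poly k a * legendre_poly k l) 1 = (\<Sum>n\<in>linearization_range a l. c n)"
    unfolding c by (simp add: poly_sum legendre_poly_at_1)
  then have "(\<Sum>n\<in>linearization_range a l. c n) = 1" by (simp add: legendre_poly_at_1)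
  moreover have "harm_dim n (2 * k + 3) * wint k (legendre_poly k a * legendre_poly k l * legendre_poly k n)
      = c n * wint k 1"
    if "n \<in> linearization_range a l" for n
  proof -
    have "wint k (legendre_poly k a * legendre_poly k l * legendre_poly k n)
        = (\<Sum>j\<in>linearization_range a l. c j * wint k (legendre_poly k j * legendre_poly k n))"
      unfolding c by (simp add: sum_distrib_right wint_sum wint_smult)
    also have "\<dots> = c n * wint k (legendre_poly k n * legendre_poly k n)"
      using that by (subst sum.remove[of _ n])
        (auto intro!: sum.neutral simp: legendre_poly_orthogonal)
    finally show ?thesis using legendre_poly_norm[of n k] by (simp add: mult_ac)
  qed
  ultimately show ?thesis by (simp flip: sum_distrib_right)
qed

text \<open>
  With the normalisation \<open>Q j = harm_dim j * P j\<close>, the triple integral as a function of two of its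
  degrees solves the wave equation, since the recurrence for multiplication of the integrand by \<open>t\<close>
  can be applied to either of the two factors. The initial values are nonnegative by orthogonality.
\<close>

lemma triple_integral_nonneg:
  assumes "l \<le> a"
  shows "wint k (legendre_poly k a * legendre_poly k l * legendre_poly k n) \<ge> 0"
proof -
  define N where "N j = harm_dim j (2 * k + 3)" for j
  define Q where "Q j = smult (N j) (legendre_poly k j)" for j
  define v where "v x y = wint k (Q x * Q y * legendre_poly k n)" for x y
  have Q_0: "[:0, 1:] * Q 0 = smult (alpha k 1) (Q 1)"
    using harm_dim_Suc[of 0 k] by (simp add: Q_def N_def alpha_def mult.commute)
  have Q_Suc: "[:0, 1:] * Q (Suc j) = smult (alpha k (j + 2)) (Q (j + 2)) + smult (1 - alpha k j) (Q j)" for j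
  proof -
    have "N (j + 2) * alpha k (j + 2) = N (Suc j) * (1 - alpha k (Suc j))"
      "N (Suc j) * alpha k (Suc j) = N j * (1 - alpha k j)"
      unfolding N_def using harm_dim_Suc[of j k] harm_dim_Suc[of "Suc j" k] by simp_all
    moreover have "[:0, 1:] * Q (Suc j) = smult (N (Suc j) * (1 - alpha k (Suc j))) (legendre_poly k (j + 2))
        + smult (N (Suc j) * alpha k (Suc j)) (legendre_poly k j)"
      unfolding Q_def mult_smult_right X_times_legendre_poly by (simp add: smult_add_right)
    ultimately show ?thesis unfolding Q_def smult_smult by (simp add: mult.commute)
  qed
  have left: "wint k ([:0, 1:] * Q (Suc x) * Q y * legendre_poly k n)
      = alpha k (x + 2) * v (x + 2) y + (1 - alpha k x) * v x y" for x y
    unfolding Q_Suc v_def distrib_right wint_add mult_smult_left wint_smult ..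
  have comm: "[:0, 1:] * Q x * Q y * legendre_poly k n = [:0, 1:] * Q y * Q x * legendre_poly k n" for x y
    by (simp only: mult_ac)
  have sym: "v x y = v y x" for x y unfolding v_def by (simp only: mult_ac)
  have "v a l \<ge> 0"
  proof (rule discrete_wave_nonneg[where \<alpha> = "alpha k" and \<gamma> = "\<lambda>j. 1 - alpha k j"])
    show "mono (alpha k)"
      by (auto simp: mono_def alpha_def divide_simps algebra_simps intro!: add_mono mult_right_mono)
    fix x y
    show "alpha k (x + 2) * v (x + 2) 0 + (1 - alpha k x) * v x 0 = alpha k 1 * v (x + 1) 1"
    proof -
      have "alpha k (x + 2) * v (x + 2) 0 + (1 - alpha k x) * v x 0
          = wint k ([:0, 1:] * Q 0 * Q (Suc x) * legendre_poly k n)"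
        unfolding left[symmetric] comm[of 0 "Suc x"] ..
      also have "\<dots> = alpha k 1 * v 1 (Suc x)"
        unfolding Q_0 v_def mult_smult_left wint_smult ..
      finally show ?thesis unfolding sym[of 1 "Suc x"] by simp
    qed
    show "alpha k (x + 2) * v (x + 2) (Suc y) + (1 - alpha k x) * v x (Suc y)
          = alpha k (y + 2) * v (x + 1) (y + 2) + (1 - alpha k y) * v (x + 1) y"
    proof -
      have "alpha k (x + 2) * v (x + 2) (Suc y) + (1 - alpha k x) * v x (Suc y)
          = alpha k (y + 2) * v (y + 2) (Suc x) + (1 - alpha k y) * v y (Suc x)"
        unfolding left[symmetric] comm[of "Suc x" "Suc y"] ..
      then show ?thesis unfolding sym[of "x + 1"] by simp
    qed
    show "v x 0 \<ge> 0"
    proof -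
      have "v x 0 = N x * wint k (legendre_poly k x * legendre_poly k n)"
        unfolding v_def Q_def by (simp add: N_def harm_dim_0 wint_smult)
      moreover have "wint k (legendre_poly k n * legendre_poly k n) > 0"
        using legendre_poly_norm[of n k] wint_1_pos[of k] harm_dim_pos[of n k] by (metis zero_less_mult_pos)
      then have "wint k (legendre_poly k x * legendre_poly k n) \<ge> 0"
        using legendre_poly_orthogonal[of x n k] by (cases "x = n") auto
      ultimately show ?thesis using harm_dim_pos[of x k] by (simp add: N_def)
    qed
    show "alpha k (Suc j) > 0" for j
      unfolding alpha_def by (intro divide_pos_pos) auto
    show "alpha k j \<le> 1 / 2" for j
      unfolding alpha_def by (subst pos_divide_le_eq) auto
  qed (use assms in \<open>auto simp: alpha_def\<close>)
  moreover have "v a l = N a * N l * wint k (legendre_poly k a * legendre_poly k l * legendre_poly k n)"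
    unfolding v_def Q_def by (simp add: wint_smult)
  moreover have "N a * N l > 0" unfolding N_def by (intro mult_pos_pos harm_dim_pos)
  ultimately show ?thesis
    using mult_le_cancel_left_pos[of "N a * N l" 0] by simp
qed

section \<open>Estimates for the explicit factors\<close>

text \<open>
  Elementary substitutes for the asymptotics \<open>n!! / (n - 1)!! ~ sqrt (2 * n / \<pi>)\<close> along odd \<open>n\<close>. They
  are preserved from \<open>n\<close> to \<open>n + 2\<close> because \<open>n * (n + 2) \<le> (n + 1)\<^sup>2\<close> and
  \<open>(n + 1) * (n + 3) \<le> (n + 2)\<^sup>2\<close>, respectively.
\<close>

lemma double_fact_bounds_odd:
  assumes "odd n"
  shows "real (double_fact n) ^ 2 \<le> real n * real (double_fact (n - 1)) ^ 2"
    and "real (n + 1) * real (double_fact (n - 1)) ^ 2 \<le> 2 * real (double_fact n) ^ 2"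
proof -
  obtain j where n: "n = Suc (2 * j)" using assms oddE by fastforce
  have "real (double_fact (Suc (2 * j))) ^ 2 \<le> real (Suc (2 * j)) * real (double_fact (2 * j)) ^ 2
      \<and> real (2 * j + 2) * real (double_fact (2 * j)) ^ 2 \<le> 2 * real (double_fact (Suc (2 * j))) ^ 2"
  proof (induction j)
    case 0
    then show ?case by simp
  next
    case (Suc j)
    define a b x where "a = real (double_fact (Suc (2 * j))) ^ 2"
      and "b = real (double_fact (2 * j)) ^ 2" and "x = real (2 * j)"
    have ab: "a \<ge> 0" "b \<ge> 0" "x \<ge> 0" by (simp_all add: a_def b_def x_def)
    have a': "real (double_fact (Suc (2 * Suc j))) ^ 2 = (x + 3) ^ 2 * a"
    proof -
      have "real (double_fact (Suc (2 * Suc j))) = (x + 3) * real (double_fact (Suc (2 * j)))"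
        by (simp add: x_def algebra_simps)
      then show ?thesis by (simp only: a_def power_mult_distrib)
    qed
    have b': "real (double_fact (2 * Suc j)) ^ 2 = (x + 2) ^ 2 * b"
    proof -
      have "real (double_fact (2 * Suc j)) = (x + 2) * real (double_fact (2 * j))"
        by (simp add: x_def algebra_simps)
      then show ?thesis by (simp only: b_def power_mult_distrib)
    qed
    have IH: "a \<le> (x + 1) * b" "(x + 2) * b \<le> 2 * a"
      using Suc unfolding a_def b_def x_def by (simp_all add: add_ac)
    have "(x + 3) ^ 2 * a \<le> (x + 3) ^ 2 * ((x + 1) * b)"
      using IH by (intro mult_left_mono) auto
    also have "\<dots> = (x + 3) * b * ((x + 3) * (x + 1))" by (simp add: power2_eq_square)
    also have "\<dots> \<le> (x + 3) * b * (x + 2) ^ 2"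
      using ab by (intro mult_left_mono) (auto simp: power2_eq_square algebra_simps)
    finally have 1: "(x + 3) ^ 2 * a \<le> (x + 3) * ((x + 2) ^ 2 * b)" by (simp add: mult_ac)
    have "(x + 4) * ((x + 2) ^ 2 * b) = ((x + 2) * (x + 4)) * ((x + 2) * b)"
      by (simp add: power2_eq_square)
    also have "\<dots> \<le> (x + 3) ^ 2 * (2 * a)"
    proof (rule mult_mono)
      show "(x + 2) * (x + 4) \<le> (x + 3)\<^sup>2" by (simp add: power2_eq_square algebra_simps)
    qed (use IH ab in auto)
    finally have 2: "(x + 4) * ((x + 2) ^ 2 * b) \<le> 2 * ((x + 3) ^ 2 * a)" by simp
    have "real (Suc (2 * Suc j)) = x + 3" "real (2 * Suc j + 2) = x + 4"
      by (simp_all add: x_def)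
    then show ?case unfolding a' b' using 1 2 by (simp only:)
  qed
  then show "real (double_fact n) ^ 2 \<le> real n * real (double_fact (n - 1)) ^ 2"
    "real (n + 1) * real (double_fact (n - 1)) ^ 2 \<le> 2 * real (double_fact n) ^ 2"
    unfolding n by simp_all
qed

lemma double_fact_shift_bounds:
  "n ^ k * double_fact n \<le> double_fact (n + 2 * k)"
  "double_fact (n + 2 * k) \<le> (n + 2 * k) ^ k * double_fact n"
proof -
  show "n ^ k * double_fact n \<le> double_fact (n + 2 * k)"
  proof (induction k)
    case (Suc k)
    then have "n * (n ^ k * double_fact n) \<le> (n + 2 * k + 2) * double_fact (n + 2 * k)"
      by (intro mult_le_mono) auto
    then show ?case by (simp add: mult.assoc)
  qed simp
  show "double_fact (n + 2 * k) \<le> (n + 2 * k) ^ k * double_fact n"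
  proof (induction k)
    case (Suc k)
    have "double_fact (n + 2 * Suc k) = (n + 2 * Suc k) * double_fact (n + 2 * k)" by simp
    also have "\<dots> \<le> (n + 2 * Suc k) * ((n + 2 * Suc k) ^ k * double_fact n)"
      by (intro mult_le_mono order_refl order_trans[OF Suc] power_mono) auto
    finally show ?case by (simp only: power_Suc mult.assoc)
  qed simp
qed

lemma fact_shift_bounds:
  "n ^ j * fact n \<le> fact (n + j)" "fact (n + j) \<le> (n + j) ^ j * (fact n :: nat)"
proof -
  show "n ^ j * fact n \<le> fact (n + j)"
  proof (induction j)
    case (Suc j)
    then have "n * (n ^ j * fact n) \<le> (n + j + 1) * fact (n + j)"
      by (intro mult_le_mono) auto
    then show ?case by (simp add: mult.assoc)
  qed simp
  show "fact (n + j) \<le> (n + j) ^ j * (fact n :: nat)"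
  proof (induction j)
    case (Suc j)
    have "fact (n + Suc j) = (n + Suc j) * (fact (n + j) :: nat)" by simp
    also have "\<dots> \<le> (n + Suc j) * ((n + Suc j) ^ j * fact n)"
      by (intro mult_le_mono order_refl order_trans[OF Suc] power_mono) auto
    finally show ?case by (simp only: power_Suc mult.assoc)
  qed simp
qed

lemma nu_sq: "(nu n (2 * k + 3))\<^sup>2 = real (double_fact (n - 1)) ^ 2 / real (double_fact (n + 2 * k)) ^ 2"
  unfolding nu_def by (simp add: power_divide power_mult_distrib flip: power_mult power_even_eq)

text \<open>
  For odd \<open>n\<close> the numbers \<open>n - 1\<close> and \<open>n + 2 * k\<close> have different parity, so the quotient of double
  factorials does not cancel to a product; both are compared with \<open>n!!\<close> instead.
\<close>

lemma nu_sq_bounds: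
  assumes "odd n"
  shows "1 / real (n + 2 * k) ^ (2 * k + 1) \<le> (nu n (2 * k + 3))\<^sup>2"
    and "(nu n (2 * k + 3))\<^sup>2 \<le> 2 / real n ^ (2 * k + 1)"
proof -
  define a b c where "a = real (double_fact n)" and "b = real (double_fact (n - 1))"
    and "c = real (double_fact (n + 2 * k))"
  have pos: "a > 0" "b > 0" "c > 0" by (simp_all add: a_def b_def c_def)
  have n: "n > 0" using assms by (cases n) auto
  have ab: "a\<^sup>2 \<le> real n * b\<^sup>2" "real (n + 1) * b\<^sup>2 \<le> 2 * a\<^sup>2"
    using double_fact_bounds_odd[OF assms] by (simp_all add: a_def b_def)
  have c: "real n ^ k * a \<le> c" "c \<le> real (n + 2 * k) ^ k * a"
    using double_fact_shift_bounds[of n k, THEN of_nat_mono[where 'a = real]]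
    unfolding a_def c_def by simp_all
  have "c\<^sup>2 \<le> (real (n + 2 * k) ^ k * a)\<^sup>2"
    using c pos by (intro power_mono) auto
  also have "\<dots> = real (n + 2 * k) ^ (2 * k) * a\<^sup>2"
    by (simp add: power_mult_distrib power_even_eq)
  also have "\<dots> \<le> real (n + 2 * k) ^ (2 * k) * (real (n + 2 * k) * b\<^sup>2)"
    by (intro mult_left_mono order_trans[OF ab(1)] mult_right_mono) auto
  finally have "c\<^sup>2 \<le> real (n + 2 * k) ^ (2 * k + 1) * b\<^sup>2" by (simp add: mult_ac)
  then show "1 / real (n + 2 * k) ^ (2 * k + 1) \<le> (nu n (2 * k + 3))\<^sup>2"
    unfolding nu_sq using pos n unfolding a_def b_def c_def
    by (simp add: divide_simps mult_ac)
  have "real n ^ (2 * k + 1) * b\<^sup>2 \<le> real n ^ (2 * k) * (real (n + 1) * b\<^sup>2)"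
    by (simp add: mult.assoc mult_left_mono algebra_simps)
  also have "\<dots> \<le> real n ^ (2 * k) * (2 * a\<^sup>2)"
    by (intro mult_left_mono ab) auto
  also have "\<dots> = 2 * (real n ^ k * a)\<^sup>2"
    by (simp add: power_mult_distrib power_even_eq)
  also have "\<dots> \<le> 2 * c\<^sup>2"
    using c pos by (intro mult_left_mono power_mono) auto
  finally show "(nu n (2 * k + 3))\<^sup>2 \<le> 2 / real n ^ (2 * k + 1)"
    unfolding nu_sq using pos n unfolding a_def b_def c_def
    by (simp add: divide_simps mult_ac)
qed

lemma harm_dim_bounds:
  shows "real n ^ (2 * k + 1) / fact (2 * k + 1) \<le> harm_dim n (2 * k + 3)"
    and "n > 0 \<Longrightarrow> harm_dim n (2 * k + 3)
      \<le> (2 * real k + 3) * (2 * real k + 1) ^ (2 * k) * real n ^ (2 * k + 1) / fact (2 * k + 1)"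
proof -
  define q where "q = (fact (n + 2 * k) :: real) / fact n"
  have h: "harm_dim n (2 * k + 3) = real (2 * n + 2 * k + 1) * q / fact (2 * k + 1)"
    unfolding harm_dim_eq q_def by (simp del: fact_Suc)
  have q: "real n ^ (2 * k) \<le> q" "q \<le> real (n + 2 * k) ^ (2 * k)"
    using fact_shift_bounds[of n "2 * k", THEN of_nat_mono[where 'a = real]]
    unfolding q_def by (simp_all add: pos_le_divide_eq pos_divide_le_eq)
  have q0: "q \<ge> 0" by (simp add: q_def)
  have "real n * real n ^ (2 * k) \<le> real (2 * n + 2 * k + 1) * q"
    using q q0 by (intro mult_mono) auto
  then show "real n ^ (2 * k + 1) / fact (2 * k + 1) \<le> harm_dim n (2 * k + 3)"
    unfolding h by (intro divide_right_mono) auto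
  assume n: "n > 0"
  have "1 \<le> real n" using n by simp
  then have n': "real k \<le> real k * real n" by (simp add: mult_le_cancel_left1)
  have "real (2 * n + 2 * k + 1) * q \<le> ((2 * real k + 3) * real n) * ((2 * real k + 1) * real n) ^ (2 * k)"
    using q q0 n' \<open>1 \<le> real n\<close>
    by (intro mult_mono order_trans[OF q(2)] power_mono) (auto simp: algebra_simps)
  then show "harm_dim n (2 * k + 3)
      \<le> (2 * real k + 3) * (2 * real k + 1) ^ (2 * k) * real n ^ (2 * k + 1) / fact (2 * k + 1)"
    unfolding h by (intro divide_right_mono) (auto simp: power_mult_distrib mult_ac)
qed

section \<open>Bounds for the singular values\<close>

text \<open>
  The end points are left out, because \<open>0 powr 0 = 0\<close> differs from \<open>0 ^ 0 = 1\<close> when \<open>k = 0\<close>.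
\<close>

lemma integral_legendre_eq_wint:
  "integral {-1..1} (\<lambda>t. legendre a (2 * k + 3) t * legendre l (2 * k + 3) t * legendre n (2 * k + 3) t
      * (1 - t\<^sup>2) powr ((real (2 * k + 3) - 3) / 2))
   = wint k (legendre_poly k a * legendre_poly k l * legendre_poly k n)"
  unfolding wint_def
proof (rule integral_spike)
  show "negligible {-1, 1 :: real}" by simp
  fix t :: real assume t: "t \<in> {-1..1} - {-1, 1}"
  then have "1 - t\<^sup>2 > 0" by (simp add: abs_square_less_1 abs_less_iff)
  then show "poly (legendre_poly k a * legendre_poly k l * legendre_poly k n) t * (1 - t\<^sup>2) ^ k
     = legendre a (2 * k + 3) t * legendre l (2 * k + 3) t * legendre n (2 * k + 3) t
       * (1 - t\<^sup>2) powr ((real (2 * k + 3) - 3) / 2)"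
    using t by (simp add: legendre_eq powr_realpow)
qed

lemma linearization_range_eq:
  assumes "even (m + l)" "l \<le> m"
  shows "{n. odd n \<and> m + 1 - l \<le> n \<and> n \<le> m + 1 + l} = linearization_range (m + 1) l"
  using assms by (auto simp: linearization_range_def)

text \<open>
  The factor of \<open>\<lambda>\<^sup>2\<close> that depends on the dimension \<open>2 * k + 3\<close> only.
\<close>

definition lambda_const :: "nat \<Rightarrow> real" where
  "lambda_const k = 2 ^ (2 * k + 4) * pi ^ (2 * k + 2)
     * (sphere_area (2 * k + 2) / (sphere_area (2 * k + 3))\<^sup>2)"

lemma lambda_const_pos: "lambda_const k > 0"
proof -
  have "sphere_area d > 0" if "d > 0" for d
    unfolding sphere_area_def using that by (intro divide_pos_pos Gamma_real_pos) auto
  then have "sphere_area (2 * k + 2) > 0" "sphere_area (2 * k + 3) > 0" by simp_all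
  then show ?thesis
    unfolding lambda_const_def by (intro mult_pos_pos divide_pos_pos zero_less_power) auto
qed

lemma lambda_eq:
  assumes "even (m + l)" "l \<le> m"
  shows "lambda m l (2 * k + 3)
    = sqrt (lambda_const k * harm_dim (m + 1) (2 * k + 3) / real (2 * m + 2 * k + 3)
     * (\<Sum>n\<in>linearization_range (m + 1) l. (nu n (2 * k + 3))\<^sup>2 * harm_dim n (2 * k + 3)
          * wint k (legendre_poly k (m + 1) * legendre_poly k l * legendre_poly k n)))"
proof -
  have "(mu m (2 * k + 3))\<^sup>2 = 2 ^ (2 * k + 4) * pi ^ (2 * k + 2) / real (2 * m + 2 * k + 3)"
    unfolding mu_def by (simp add: eval_nat_numeral)
  moreover have "2 * k + 3 - 1 = 2 * k + 2" by simp
  moreover have "H * (M / D) * s / t * S = M * (s / t) * H / D * S" for H M D s t S :: real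
    by (simp add: mult_ac)
  ultimately show ?thesis
    unfolding lambda_def integral_legendre_eq_wint linearization_range_eq[OF assms] lambda_const_def
    by (simp only:)
qed

lemma lambda_lower_bound:
  obtains c where "c > 0"
    "\<And>m l. m \<ge> 1 \<Longrightarrow> l \<le> m \<Longrightarrow> even (m + l) \<Longrightarrow> c * real m powr (- 1 / 2) \<le> lambda m l (2 * k + 3)"
proof -
  define r where "r = 2 * k + 1"
  define A where "A = lambda_const k * wint k 1 / (fact r * (2 * real k + 5) * (2 * real k + 3) ^ r)"
  have A: "A > 0" unfolding A_def using lambda_const_pos[of k] wint_1_pos[of k] by simp
  have "sqrt A * real m powr (- 1 / 2) \<le> lambda m l (2 * k + 3)"
    if m: "m \<ge> 1" and l: "l \<le> m" "even (m + l)" for m l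
  proof -
    define S where "S = (\<Sum>n\<in>linearization_range (m + 1) l. (nu n (2 * k + 3))\<^sup>2 * harm_dim n (2 * k + 3)
          * wint k (legendre_poly k (m + 1) * legendre_poly k l * legendre_poly k n))"
    define H where "H = harm_dim (m + 1) (2 * k + 3)"
    \<comment> \<open>A common lower bound of all \<open>\<nu>\<^sup>2\<close> in the sum, since \<open>n + 2 * k \<le> 2 * m + 1 + 2 * k\<close>.\<close>
    define y where "y = 1 / ((2 * real k + 3) * real m) ^ r"
    have m': "real k \<le> real k * real m" "1 \<le> real m" using m by (simp_all add: mult_le_cancel_left1)
    have "y * wint k 1 = (\<Sum>n\<in>linearization_range (m + 1) l. y * (harm_dim n (2 * k + 3)
          * wint k (legendre_poly k (m + 1) * legendre_poly k l * legendre_poly k n)))"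
      using l sum_triple_integrals[of l "m + 1" k] by (simp flip: sum_distrib_left)
    also have "\<dots> \<le> S"
      unfolding S_def mult.assoc[of "_\<^sup>2"]
    proof (intro sum_mono mult_right_mono mult_nonneg_nonneg)
      fix n assume "n \<in> linearization_range (m + 1) l"
      then have n: "odd n" "n \<le> 2 * m + 1" using l by (auto simp: linearization_range_def)
      have "real (n + 2 * k) \<le> (2 * real k + 3) * real m"
        using n m' by (simp add: algebra_simps)
      then have "y \<le> 1 / real (n + 2 * k) ^ r"
        unfolding y_def using n m odd_pos[OF n(1)]
          by (intro divide_left_mono power_mono) (auto intro!: mult_pos_pos zero_less_power)
      also have "\<dots> \<le> (nu n (2 * k + 3))\<^sup>2" using nu_sq_bounds(1)[OF n(1), of k] by (simp add: r_def)
      finally show "y \<le> (nu n (2 * k + 3))\<^sup>2" .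
    qed (use harm_dim_pos less_imp_le triple_integral_nonneg l in auto)
    finally have S: "y * wint k 1 \<le> S" .
    have "real m ^ r / fact r \<le> real (m + 1) ^ r / fact r"
      by (intro divide_right_mono power_mono) auto
    then have H: "real m ^ r / fact r \<le> H"
      using harm_dim_bounds(1)[of "m + 1" k] unfolding H_def r_def by linarith
    have H0: "H > 0" unfolding H_def by (rule harm_dim_pos)
    have y0: "y > 0" unfolding y_def using m' by simp
    have "A / real m = lambda_const k * (real m ^ r / fact r) / ((2 * real k + 5) * real m) * (y * wint k 1)"
    proof -
      have "L * w / (F * E * P) / x = L * (q / F) / (E * x) * (1 / (P * q) * w)"
        if "q \<noteq> 0" for L w F E P x q :: real
        using that by simp
      then show ?thesis unfolding A_def y_def power_mult_distrib using m' by simp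
    qed
    also have "\<dots> \<le> lambda_const k * H / real (2 * m + 2 * k + 3) * S"
      using lambda_const_pos[of k] wint_1_pos[of k] H H0 S m' y0
      by (intro mult_mono frac_le mult_left_mono)
        (auto simp: algebra_simps intro!: divide_nonneg_nonneg mult_nonneg_nonneg)
    finally have "sqrt (A / real m) \<le> lambda m l (2 * k + 3)"
      unfolding lambda_eq[OF l(2,1)] S_def[symmetric] H_def[symmetric] by (rule real_sqrt_le_mono)
    moreover have "sqrt (A / real m) = sqrt A * real m powr (- 1 / 2)"
      using m' by (simp add: real_sqrt_divide powr_minus_divide powr_half_sqrt)
    ultimately show ?thesis by simp
  qed
  then show ?thesis using that[of "sqrt A"] A by simp
qed

text \<open>
  For \<open>l = 0\<close> the sum has the single term \<open>n = m + 1\<close>.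
\<close>

lemma lambda_zero_upper_bound:
  obtains C where "C > 0"
    "\<And>m. m \<ge> 1 \<Longrightarrow> even m \<Longrightarrow> \<bar>lambda m 0 (2 * k + 3)\<bar> \<le> C * real m powr (- 1 / 2)"
proof -
  define r where "r = 2 * k + 1"
  define U where "U = 2 * ((2 * real k + 3) * (2 * real k + 1) ^ (2 * k) / fact r)"
  have U: "U > 0" unfolding U_def by (auto intro!: mult_pos_pos divide_pos_pos zero_less_power)
  define A where "A = lambda_const k * U * wint k 1"
  have A: "A > 0" unfolding A_def using U lambda_const_pos[of k] wint_1_pos[of k] by simp
  have "\<bar>lambda m 0 (2 * k + 3)\<bar> \<le> sqrt A * real m powr (- 1 / 2)" if m: "m \<ge> 1" "even m" for m
  proof -
    define H where "H = harm_dim (m + 1) (2 * k + 3)"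
    define v where "v = (nu (m + 1) (2 * k + 3))\<^sup>2"
    have H0: "H > 0" unfolding H_def by (rule harm_dim_pos)
    have v0: "v \<ge> 0" by (simp add: v_def)
    have "linearization_range (m + 1) 0 = {m + 1}" by (auto simp: linearization_range_def)
    then have l: "lambda m 0 (2 * k + 3)
        = sqrt (lambda_const k * H / real (2 * m + 2 * k + 3) * (v * wint k 1))"
      using lambda_eq[of m 0 k] sum_triple_integrals[of 0 "m + 1" k] m
      by (simp add: H_def v_def mult.assoc)
    have "H * v \<le> ((2 * real k + 3) * (2 * real k + 1) ^ (2 * k) * real (m + 1) ^ r / fact r) * (2 / real (m + 1) ^ r)"
      using harm_dim_bounds(2)[of "m + 1" k] nu_sq_bounds(2)[of "m + 1" k] m v0
      unfolding H_def v_def r_def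
        by (intro mult_mono) (auto intro!: divide_nonneg_nonneg mult_nonneg_nonneg)
    also have "\<dots> = U" unfolding U_def by (simp del: of_nat_add of_nat_Suc)
    finally have Hv: "H * v \<le> U" .
    have "lambda_const k * H / real (2 * m + 2 * k + 3) * (v * wint k 1)
        = lambda_const k * wint k 1 * (H * v) / real (2 * m + 2 * k + 3)" by simp
    also have "\<dots> \<le> lambda_const k * wint k 1 * U / real m"
      using Hv m lambda_const_pos[of k] wint_1_pos[of k] U
      by (intro frac_le mult_left_mono) auto
    also have "\<dots> = A / real m" by (simp add: A_def)
    finally have "lambda m 0 (2 * k + 3) \<le> sqrt (A / real m)"
      unfolding l by (rule real_sqrt_le_mono)
    moreover have "sqrt (A / real m) = sqrt A * real m powr (- 1 / 2)"
      using m by (simp add: real_sqrt_divide powr_minus_divide powr_half_sqrt)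
    moreover have "lambda m 0 (2 * k + 3) \<ge> 0"
      unfolding l using lambda_const_pos[of k] wint_1_pos[of k] H0 v0 by simp
    ultimately show ?thesis by simp
  qed
  then show ?thesis using that[of "sqrt A"] A by simp
qed

theorem theorem4p8:
  fixes d :: nat
  assumes "d \<ge> 3" and "odd d"
  shows "(\<exists>c>0. \<forall>m\<ge>1. \<forall>l\<le>m. even (m + l) \<longrightarrow>
            \<bar>lambda m l d\<bar> \<ge> c * real m powr (- 1 / 2)) \<and>
         (\<forall>\<beta>::real. \<beta> > - 1 / 2 \<longrightarrow>
            \<not> (\<exists>c>0. \<forall>m\<ge>1. \<forall>l\<le>m. even (m + l) \<longrightarrow>
                  \<bar>lambda m l d\<bar> \<ge> c * real m powr \<beta>))"
proof (intro conjI allI impI notI)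
  define k where "k = (d - 3) div 2"
  have d: "d = 2 * k + 3" unfolding k_def using assms by (auto elim!: oddE)
  obtain c where "c > 0"
    and c: "\<And>m l. m \<ge> 1 \<Longrightarrow> l \<le> m \<Longrightarrow> even (m + l) \<Longrightarrow> c * real m powr (- 1 / 2) \<le> lambda m l d"
    using lambda_lower_bound[of k] d by metis
  have "c * real m powr (- 1 / 2) \<le> \<bar>lambda m l d\<bar>" if "m \<ge> 1" "l \<le> m" "even (m + l)" for m l
    using c[OF that] by linarith
  with \<open>c > 0\<close> show "\<exists>c>0. \<forall>m\<ge>1. \<forall>l\<le>m. even (m + l) \<longrightarrow> \<bar>lambda m l d\<bar> \<ge> c * real m powr (- 1 / 2)"
    by blast
  obtain C where "C > 0"
    and C: "\<And>m. m \<ge> 1 \<Longrightarrow> even m \<Longrightarrow> \<bar>lambda m 0 d\<bar> \<le> C * real m powr (- 1 / 2)"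
    using lambda_zero_upper_bound[of k] d by metis
  fix \<beta> :: real
  assume \<beta>: "\<beta> > - 1 / 2"
    and "\<exists>b>0. \<forall>m\<ge>1. \<forall>l\<le>m. even (m + l) \<longrightarrow> \<bar>lambda m l d\<bar> \<ge> b * real m powr \<beta>"
  then obtain b where "b > 0"
    and b: "\<And>m l. m \<ge> 1 \<Longrightarrow> l \<le> m \<Longrightarrow> even (m + l) \<Longrightarrow> \<bar>lambda m l d\<bar> \<ge> b * real m powr \<beta>"
    by blast
  define e where "e = \<beta> + 1 / 2"
  have e: "e > 0" using \<beta> by (simp add: e_def)
  \<comment> \<open>A large even \<open>m\<close>, at which \<open>l = 0\<close> is admissible.\<close>
  obtain j :: nat where j: "(C / b) powr (1 / e) < real j" using reals_Archimedean2 by blast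
  define m where "m = 2 * j"
  have "real j > 0" using j powr_ge_zero[of "C / b" "1 / e"] by linarith
  then have m: "m \<ge> 1" "even m" "real m > 0" unfolding m_def by auto
  have "C / b = ((C / b) powr (1 / e)) powr e"
    using e \<open>C > 0\<close> \<open>b > 0\<close> by (simp add: powr_powr)
  also have "\<dots> < real m powr e"
    using j e \<open>real j > 0\<close> by (intro powr_less_mono2) (auto simp: m_def)
  also have "\<dots> = real m powr \<beta> / real m powr (- 1 / 2)"
    by (simp add: e_def flip: powr_diff)
  finally have "C * real m powr (- 1 / 2) < b * real m powr \<beta>"
    using \<open>b > 0\<close> m(3) by (simp add: field_simps)
  moreover have "b * real m powr \<beta> \<le> C * real m powr (- 1 / 2)"
    using b[of m 0] C[of m] m by force
  ultimately show False by simp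
qed

end
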